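(* Let $X$ be a classical Meixner random variable with parameters $\alpha,\alpha_0,\beta,t\in\mathbb{R}$, $t>0$, and let $N$ be its number operator. Put $\Delta=\alpha^2-4\beta$ and $\tau=2t-\alpha\alpha_0$. (i) If $\Delta\ne0$ and $\delta\in\mathbb{C}$ satisfies $\delta^2=\Delta$, then $$N=\frac{X-\alpha_0}{2\delta}\big(\mathcal{T}_\delta-\mathcal{T}_{-\delta}\big)-\frac{1}{2\delta^2}(\alpha X+\tau)\big(\mathcal{T}_\delta+\mathcal{T}_{-\delta}-2I\big).$$ (ii) If $\Delta=0$, then $$N=(X-\alpha_0)D-\frac12(\alpha X+\tau)D^2 .$$
   Context: Let $X$ be a real-valued random variable with finite moments of all orders on a probability space $(\Omega,\mathcal F,P)$. Let $F$ be the space of random variables $f(X)$ with $f\in\mathbb{C}[x]$, let $F_n$ be the subspace of those $f(X)$ with $\deg f\le n$, $F_{-1}=\{0\}$, and $G_n=F_n\ominus F_{n-1}$ (orthogonal complement in $L^2(\Omega,P)$). The number operator $N:F\to F$ is the linear operator with $Ng=ng$ for every $g\in G_n$, $n\ge0$. If $G_n\ne\{0\}$, let $f_n(X)$ be the unique element of $G_n$ with $f_n$ monic of degree $n$. If $G_n=\{0\}$, put $f_n(X)=0$; also $f_{-1}(X)=0$. There are real numbers $\alpha_n$, $\omega_n$ (the Szegő–Jacobi parameters of $X$) with $Xf_n(X)=f_{n+1}(X)+\alpha_nf_n(X)+\omega_nf_{n-1}(X)$ for $n\ge0$. $X$ is a classical Meixner random variable with parameters $\alpha,\alpha_0,\beta,t\in\mathbb{R}$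 if its Szegő–Jacobi parameters are $\alpha_n=\alpha n+\alpha_0$ and $\omega_n=\beta n^2+(t-\beta)n$, where either ($\beta\ge0$ and $t\ge0$) or ($\beta<0$ and $t\in-\mathbb{N}\beta=\{-k\beta:k\in\mathbb N\}$). If $X$ takes exactly $K<\infty$ values (almost surely), the convention is $\omega_K=0$, and the formulas are required for $\alpha_n$ with $0\le n\le K-1$ and for $\omega_n$ with $1\le n\le K$; otherwise they are required for all $n\geq 0$ (for $\alpha_n$) and all $n\ge1$ (for $\omega_n$). Only $t>0$ is considered (for $t=0$, $X$ is constant). Operator notation: $I$ is the identity, $D=d/dx$ is differentiation, and for $c\in\mathbb{C}$, $\mathcal{T}_c$ is the translation operator $\mathcal{T}_cf(X)=f(X+c)$. A polynomial in $X$ written to the left of an operator denotes multiplication by it. An operator identity $T=\sum_j A_j(X)S_j$, where each $S_j$ is built from $D$ or translations, means: for every polynomial $f\in\mathbb{C}[x]$, $T(f(X))=\sum_jA_j(X)\,(S_jf)(X)$ almost surely, where the same polynomial $f$ is used in all terms of the right-hand side. *)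

theory Defs
  imports "HOL-Probability.Probability" "HOL-Computational_Algebra.Polynomial"
begin

definition finite_moments :: "'a measure \<Rightarrow> ('a \<Rightarrow> real) \<Rightarrow> bool" where
  "finite_moments M X \<longleftrightarrow>
     X \<in> borel_measurable M \<and> (\<forall>n::nat. integrable M (\<lambda>\<omega>. X \<omega> ^ n))"

definition rv_poly :: "('a \<Rightarrow> real) \<Rightarrow> complex poly \<Rightarrow> 'a \<Rightarrow> complex" where
  "rv_poly X p = (\<lambda>\<omega>. poly p (of_real (X \<omega>)))"

text \<open>
  As usual in \<open>L\<^sup>2\<close>, random variables are identified when they agree almost surely. No quotient
  is formed: the spaces below consist of all measurable representatives. The constraint on the
  degree is vacuous for the zero polynomial (whose degree is \<open>-\<infinity>\<close> in the usual convention,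
  but \<open>0\<close> in the library), so that \<open>poly_rvs_le M X (-1)\<close> is the zero space.
\<close>

definition poly_rvs :: "'a measure \<Rightarrow> ('a \<Rightarrow> real) \<Rightarrow> ('a \<Rightarrow> complex) set" where
  "poly_rvs M X = {g \<in> borel_measurable M. \<exists>p. AE \<omega> in M. g \<omega> = rv_poly X p \<omega>}"

definition poly_rvs_le :: "'a measure \<Rightarrow> ('a \<Rightarrow> real) \<Rightarrow> int \<Rightarrow> ('a \<Rightarrow> complex) set" where
  "poly_rvs_le M X n = {g \<in> borel_measurable M.
     \<exists>p. (p = 0 \<or> int (degree p) \<le> n) \<and> (AE \<omega> in M. g \<omega> = rv_poly X p \<omega>)}"

definition l2_inner :: "'a measure \<Rightarrow> ('a \<Rightarrow> complex) \<Rightarrow> ('a \<Rightarrow> complex) \<Rightarrow> complex" where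
  "l2_inner M g h = (LINT \<omega>|M. g \<omega> * cnj (h \<omega>))"

text \<open>The homogeneous chaos \<open>G\<^sub>n = F\<^sub>n \<ominus> F\<^sub>n\<^sub>-\<^sub>1\<close>.\<close>

definition chaos :: "'a measure \<Rightarrow> ('a \<Rightarrow> real) \<Rightarrow> nat \<Rightarrow> ('a \<Rightarrow> complex) set" where
  "chaos M X n = {g \<in> poly_rvs_le M X (int n).
     \<forall>h \<in> poly_rvs_le M X (int n - 1). l2_inner M g h = 0}"

text \<open>\<open>N\<close> is specified as an operator on representatives that descends to almost sure classes.\<close>

definition number_operator ::
  "'a measure \<Rightarrow> ('a \<Rightarrow> real) \<Rightarrow> (('a \<Rightarrow> complex) \<Rightarrow> 'a \<Rightarrow> complex) \<Rightarrow> bool" where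
  "number_operator M X N \<longleftrightarrow>
     (\<forall>g \<in> poly_rvs M X. N g \<in> poly_rvs M X) \<and>
     (\<forall>g \<in> poly_rvs M X. \<forall>h \<in> poly_rvs M X.
        (AE \<omega> in M. g \<omega> = h \<omega>) \<longrightarrow> (AE \<omega> in M. N g \<omega> = N h \<omega>)) \<and>
     (\<forall>g \<in> poly_rvs M X. \<forall>h \<in> poly_rvs M X. \<forall>a b.
        AE \<omega> in M. N (\<lambda>\<omega>'. a * g \<omega>' + b * h \<omega>') \<omega> = a * N g \<omega> + b * N h \<omega>) \<and>
     (\<forall>n. \<forall>g \<in> chaos M X n. AE \<omega> in M. N g \<omega> = of_nat n * g \<omega>)"

text \<open>
  If \<open>G\<^sub>n\<close> is not the zero space, then \<open>X\<close> is not concentrated on \<open>n\<close> or fewer points, so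
  \<open>f\<^sub>n\<close> is unique as a polynomial and not merely as a random variable.
\<close>

definition orth_poly :: "'a measure \<Rightarrow> ('a \<Rightarrow> real) \<Rightarrow> nat \<Rightarrow> complex poly" where
  "orth_poly M X n =
     (if \<forall>g \<in> chaos M X n. AE \<omega> in M. g \<omega> = 0 then 0
      else (THE p. degree p = n \<and> lead_coeff p = 1 \<and> rv_poly X p \<in> chaos M X n))"

definition szego_jacobi ::
  "'a measure \<Rightarrow> ('a \<Rightarrow> real) \<Rightarrow> (nat \<Rightarrow> real) \<Rightarrow> (nat \<Rightarrow> real) \<Rightarrow> bool" where
  "szego_jacobi M X a w \<longleftrightarrow> (\<forall>n. AE \<omega> in M.
     of_real (X \<omega>) * rv_poly X (orth_poly M X n) \<omega> =
       rv_poly X (orth_poly M X (n + 1)) \<omega>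
       + of_real (a n) * rv_poly X (orth_poly M X n) \<omega>
       + of_real (w n) * (if n = 0 then 0 else rv_poly X (orth_poly M X (n - 1)) \<omega>))"

definition takes_exactly :: "'a measure \<Rightarrow> ('a \<Rightarrow> real) \<Rightarrow> nat \<Rightarrow> bool" where
  "takes_exactly M X K \<longleftrightarrow> (\<exists>S. finite S \<and> card S = K \<and> (AE \<omega> in M. X \<omega> \<in> S) \<and>
     (\<forall>x \<in> S. measure M {\<omega> \<in> space M. X \<omega> = x} > 0))"

text \<open>
  The Szego-Jacobi parameters \<open>a n\<close> (for \<open>n \<ge> K\<close>) and \<open>w n\<close> (for \<open>n = 0\<close> and \<open>n > K\<close>) are
  not determined by the recurrence when \<open>X\<close> takes exactly \<open>K\<close> values; nothing is required of them.
\<close>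

definition classical_meixner ::
  "'a measure \<Rightarrow> ('a \<Rightarrow> real) \<Rightarrow> real \<Rightarrow> real \<Rightarrow> real \<Rightarrow> real \<Rightarrow> bool" where
  "classical_meixner M X \<alpha> \<alpha>\<^sub>0 \<beta> t \<longleftrightarrow>
     finite_moments M X \<and>
     ((\<beta> \<ge> 0 \<and> t \<ge> 0) \<or> (\<beta> < 0 \<and> (\<exists>k::nat. t = - (real k * \<beta>)))) \<and>
     (\<exists>a w. szego_jacobi M X a w \<and>
       (\<forall>K. takes_exactly M X K \<longrightarrow>
          w K = 0 \<and>
          (\<forall>n. n < K \<longrightarrow> a n = \<alpha> * real n + \<alpha>\<^sub>0) \<and>
          (\<forall>n. 1 \<le> n \<and> n \<le> K \<longrightarrow> w n = \<beta> * (real n)\<^sup>2 + (t - \<beta>) * real n)) \<and>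
       ((\<nexists>K. takes_exactly M X K) \<longrightarrow>
          (\<forall>n. a n = \<alpha> * real n + \<alpha>\<^sub>0) \<and>
          (\<forall>n\<ge>1. w n = \<beta> * (real n)\<^sup>2 + (t - \<beta>) * real n)))"

definition translate :: "complex \<Rightarrow> complex poly \<Rightarrow> complex poly" where
  "translate c f = pcompose f [:c, 1:]"

end

theory Submission
  imports Defs
begin

text \<open>
  Both operators in the theorem have the form \<open>L = (x - \<alpha>\<^sub>0) A - (\<alpha>x + \<tau>) B\<close> where \<open>A\<close> and \<open>B\<close>
  annihilate constants and satisfy \<open>[A, x] = 1 + \<Delta>B\<close> and \<open>[B, x] = A\<close>. Put \<open>C = [L, x]\<close>; then
  \<open>[C, x] = \<Delta>L - \<alpha>x - \<tau>\<close>. For the monic polynomials \<open>p\<^sub>n\<close> given by the Meixner recurrence, these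
  relations yield by simultaneous induction \<open>L p\<^sub>n = n p\<^sub>n\<close> and \<open>C p\<^sub>n = p\<^sub>n\<^sub>+\<^sub>1 - \<omega>\<^sub>n p\<^sub>n\<^sub>-\<^sub>1\<close>.
  It remains to see that \<open>p\<^sub>n(X)\<close> lies in \<open>G\<^sub>n\<close> for every \<open>n\<close>. If \<open>X\<close> takes exactly \<open>K\<close> values,
  then \<open>p\<^sub>K(X) = 0\<close>, and since \<open>\<omega>\<^sub>K = 0\<close> the recurrence gives \<open>p\<^sub>n(X) = 0\<close> for all \<open>n \<ge> K\<close>.
\<close>

section \<open>Monic polynomials defined by a three-term recurrence\<close>

text \<open>The guard at n = 0 encodes the convention f_{-1} = 0, so that \<open>w 0\<close> never
  enters.\<close>

fun recurrence_poly :: "(nat \<Rightarrow> 'a::comm_ring_1) \<Rightarrow> (nat \<Rightarrow> 'a) \<Rightarrow> nat \<Rightarrow> 'a poly" where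
  "recurrence_poly a w 0 = 1"
| "recurrence_poly a w (Suc n) = [:- a n, 1:] * recurrence_poly a w n
     - (if n = 0 then 0 else smult (w n) (recurrence_poly a w (n - 1)))"

lemma recurrence_poly_degree_monic:
  fixes a w :: "nat \<Rightarrow> 'a::idom"
  shows "degree (recurrence_poly a w n) = n \<and> lead_coeff (recurrence_poly a w n) = 1"
proof (induction n rule: less_induct)
  case (less n)
  show ?case
  proof (cases n)
    case 0
    then show ?thesis by simp
  next
    case (Suc m)
    let ?u = "[:- a m, 1:] * recurrence_poly a w m"
    let ?v = "if m = 0 then 0 else smult (w m) (recurrence_poly a w (m - 1))"
    have m: "degree (recurrence_poly a w m) = m" "lead_coeff (recurrence_poly a w m) = 1"
      using less.IH[of m] Suc by auto
    have "recurrence_poly a w m \<noteq> 0"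
      using m(2) by auto
    then have u: "degree ?u = Suc m"
      using m(1) by (subst degree_mult_eq) auto
    have lu: "lead_coeff ?u = 1"
      using m(2) by (subst lead_coeff_mult) auto
    have v: "degree ?v < Suc m"
    proof (cases "m = 0")
      case False
      then show ?thesis
        using less.IH[of "m - 1"] Suc degree_smult_le[of "w m" "recurrence_poly a w (m - 1)"] by auto
    qed simp
    have "degree (?u - ?v) = Suc m"
      using u v degree_add_eq_left[of "- ?v" ?u] by simp
    moreover have "coeff (?u - ?v) (Suc m) = 1"
      using u v lu by (simp only: coeff_diff coeff_eq_0[OF v]) simp
    ultimately show ?thesis
      unfolding Suc recurrence_poly.simps by simp
  qed
qed

lemma linear_factor_shift:
  fixes b c :: "'a::comm_ring_1"
  shows "[:- (b + c), 1:] * f = [:- b, 1:] * f - smult c f"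
  by (simp add: smult_add_left smult_diff_left)

section \<open>Commutator algebra of the operators and their eigenpolynomials\<close>

definition meixner_op ::
  "'a::comm_ring_1 \<Rightarrow> 'a \<Rightarrow> 'a \<Rightarrow> ('a poly \<Rightarrow> 'a poly) \<Rightarrow> ('a poly \<Rightarrow> 'a poly) \<Rightarrow> 'a poly \<Rightarrow> 'a poly"
where
  "meixner_op \<alpha> \<alpha>\<^sub>0 \<tau> A B f = [:- \<alpha>\<^sub>0, 1:] * A f - [:\<tau>, \<alpha>:] * B f"

text \<open>With \<delta> a square root of \<Delta>, the model is A = sinh(\<delta>D)/\<delta> and B
  = (cosh(\<delta>D) - 1)/\<delta>^2, whose limits as \<delta> tends to 0 are D and D^2/2. The
  commutation rules involve only \<Delta>, neither \<delta> nor a division, so one argument serves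
  both cases of the theorem.\<close>

locale meixner_operators =
  fixes \<alpha> \<alpha>\<^sub>0 \<beta> t \<tau> \<Delta> :: "'a::idom" and A B :: "'a poly \<Rightarrow> 'a poly"
  assumes A_diff: "A (f - g) = A f - A g" and B_diff: "B (f - g) = B f - B g"
    and A_smult: "A (smult c f) = smult c (A f)" and B_smult: "B (smult c f) = smult c (B f)"
    and A_1: "A 1 = 0" and B_1: "B 1 = 0"
    and A_X: "A ([:0, 1:] * f) = [:0, 1:] * A f + f + smult \<Delta> (B f)"
    and B_X: "B ([:0, 1:] * f) = [:0, 1:] * B f + A f"
    and Delta_eq: "\<Delta> = \<alpha>\<^sup>2 - 4 * \<beta>" and tau_eq: "\<tau> = 2 * t - \<alpha> * \<alpha>\<^sub>0"
begin

abbreviation "mean n \<equiv> \<alpha> * of_nat n + \<alpha>\<^sub>0"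
abbreviation "var n \<equiv> \<beta> * (of_nat n)\<^sup>2 + (t - \<beta>) * of_nat n"
abbreviation "p \<equiv> recurrence_poly mean var"
abbreviation "L \<equiv> meixner_op \<alpha> \<alpha>\<^sub>0 \<tau> A B"

text \<open>This is [L, x] written out with \<open>A_X\<close> and \<open>B_X\<close>.\<close>

definition C :: "'a poly \<Rightarrow> 'a poly" where
  "C f = [:- \<alpha>\<^sub>0, 1:] * (f + smult \<Delta> (B f)) - [:\<tau>, \<alpha>:] * A f"

lemma L_diff: "L (f - g) = L f - L g"
  unfolding meixner_op_def A_diff B_diff by algebra

lemma C_diff: "C (f - g) = C f - C g"
  unfolding C_def A_diff B_diff smult_diff_right by algebra

lemma L_smult: "L (smult c f) = smult c (L f)"
  unfolding meixner_op_def A_smult B_smult by (simp add: smult_diff_right)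

lemma C_smult: "C (smult c f) = smult c (C f)"
  unfolding C_def A_smult B_smult by (simp add: smult_diff_right smult_add_right mult_ac)

text \<open>Scalars commute with \<open>L\<close>, so replacing x by x - c leaves the commutator
  unchanged.\<close>

lemma L_linear_factor: "L ([:- c, 1:] * f) = [:- c, 1:] * L f + C f"
proof -
  have "[:- c, 1:] * f = [:0, 1:] * f - smult c f" for f :: "'a poly"
    by (simp add: algebra_simps)
  moreover have "L ([:0, 1:] * f) = [:0, 1:] * L f + C f"
    unfolding meixner_op_def C_def A_X B_X by (simp only: algebra_simps)
  ultimately show ?thesis
    by (simp add: L_diff L_smult)
qed

lemma C_linear_factor:
  "C ([:- c, 1:] * f) = [:- c, 1:] * C f + smult \<Delta> (L f) - [:\<tau>, \<alpha>:] * f"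
proof -
  have "[:- c, 1:] * f = [:0, 1:] * f - smult c f" for f :: "'a poly"
    by (simp add: algebra_simps)
  moreover have "C ([:0, 1:] * f) = [:0, 1:] * C f + smult \<Delta> (L f) - [:\<tau>, \<alpha>:] * f"
    unfolding meixner_op_def C_def A_X B_X
    by (simp add: smult_add_right smult_diff_right algebra_simps del: mult_pCons_left mult_pCons_right)
  ultimately show ?thesis
    by (simp add: C_diff C_smult)
qed

text \<open>Because \<open>var 0 = 0\<close>, the recurrence needs no special case at n = 0, where
  \<open>n - 1\<close> is truncated to 0.\<close>

lemma p_Suc: "p (Suc n) = [:- mean n, 1:] * p n - smult (var n) (p (n - 1))"
  by (cases n) auto

text \<open>The two claims are proved together: the eigenvalue equation at n = m + 1 uses the
  formula for \<open>C (p m)\<close>, and the formula for \<open>C (p n)\<close> uses the eigenvalue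
  equation at m.\<close>

lemma L_C_p: "L (p n) = smult (of_nat n) (p n) \<and> C (p n) = p (Suc n) - smult (var n) (p (n - 1))"
proof (induction n rule: less_induct)
  case (less n)
  show ?case
  proof (cases n)
    case 0
    then show ?thesis
      by (simp add: meixner_op_def C_def A_1 B_1)
  next
    case (Suc m)
    define P Q R where "P = p m" and "Q = smult (var m) (p (m - 1))"
      and "R = smult (var m * var (m - 1)) (p (m - 1 - 1))"
    define v where "v = var m"
    define mu where "mu = mean m"
    have P: "L P = smult (of_nat m) P" "C P = p n - Q"
      using less.IH[of m] Suc by (auto simp: P_def Q_def)
    \<comment> \<open>Since \<open>var 0 = 0\<close>, the next three equations also hold for \<open>m = 0\<close>.\<close>
    have LQ: "L Q = smult (of_nat m - 1) Q"
      and CQ: "C Q = smult v P - R"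
      and XQ: "[:- mu, 1:] * Q = smult v P + R - smult \<alpha> Q"
    proof -
      have "L Q = smult (of_nat m - 1) Q \<and> C Q = smult v P - R
        \<and> [:- mu, 1:] * Q = smult v P + R - smult \<alpha> Q"
      proof (cases m)
        case 0
        then show ?thesis
          by (simp add: Q_def R_def v_def meixner_op_def C_def A_smult[of 0 0, simplified]
              B_smult[of 0 0, simplified])
      next
        case (Suc k)
        \<comment> \<open>The mean grows by \<alpha> from k to m = k + 1. This correction allows the
          recurrence for \<open>p k\<close> to be used with the factor x - mu.\<close>
        have mu: "[:- mu, 1:] * f = [:- mean k, 1:] * f - smult \<alpha> f" for f
          using linear_factor_shift[of "mean k" \<alpha> f] unfolding mu_def Suc by (simp add: algebra_simps)
        have PX: "[:- mean k, 1:] * p k = P + smult (var k) (p (k - 1))"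
          using p_Suc[of k] unfolding P_def Suc by simp
        have IH: "L (p k) = smult (of_nat k) (p k)" "C (p k) = P - smult (var k) (p (k - 1))"
          using less.IH[of k] \<open>n = Suc m\<close> Suc by (auto simp: P_def)
        have Q: "Q = smult v (p k)" and R: "R = smult v (smult (var k) (p (k - 1)))"
          unfolding Q_def R_def v_def Suc by simp_all
        have "[:- mu, 1:] * Q = smult v ([:- mean k, 1:] * p k) - smult \<alpha> Q"
          unfolding mu by (simp only: Q mult_smult_right)
        moreover have "L Q = smult (of_nat m - 1) Q"
          unfolding Q L_smult IH using Suc by (simp add: mult.commute)
        ultimately show ?thesis
          unfolding PX unfolding R unfolding Q C_smult IH by (simp add: smult_add_right smult_diff_right)
      qed
      then show "L Q = smult (of_nat m - 1) Q" "C Q = smult v P - R"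
        "[:- mu, 1:] * Q = smult v P + R - smult \<alpha> Q" by auto
    qed
    have n: "p n = [:- mu, 1:] * P - Q"
      using p_Suc[of m] unfolding Suc P_def Q_def mu_def .
    \<comment> \<open>Expanding gives m(x - mu)P + (p_n - Q) - (m - 1)Q, which is m((x - mu)P - Q) +
      p_n = (m + 1)p_n.\<close>
    have "L (p n) = smult (of_nat n) (p n)"
      unfolding n L_diff L_linear_factor P LQ unfolding n Suc
      by (simp add: smult_add_left smult_diff_left smult_add_right smult_diff_right algebra_simps)
    moreover have "C (p n) = p (Suc n) - smult (var n) P"
    proof -
      have P_n: "P = p (n - 1)"
        by (simp add: P_def Suc)
      have mean_n: "[:- mean n, 1:] * f = [:- mu, 1:] * f - smult \<alpha> f" for f
        using linear_factor_shift[of mu \<alpha> f] unfolding mu_def Suc by (simp add: algebra_simps)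
      \<comment> \<open>This is where the values of \<Delta> and \<tau> enter: twice the increment
        of \<open>var\<close> from m to m + 1 is 4\<beta>m + 2t, and so is \<tau> + \<alpha> mu -
        \<Delta>m. Doubling avoids a division by 2.\<close>
      have var_n: "var n + var n = v + v + \<tau> + \<alpha> * mu - \<Delta> * of_nat m"
        unfolding v_def mu_def Suc Delta_eq tau_eq by (simp add: algebra_simps power2_eq_square)
      have affine: "[:\<tau>, \<alpha>:] * P = smult \<tau> P + smult \<alpha> (p n + Q + smult mu P)"
        unfolding n by (simp add: algebra_simps smult_add_right)
      \<comment> \<open>After substitution the two R terms cancel, and so do the \<alpha>Q terms
        from \<open>XQ\<close> and \<open>affine\<close>. By \<open>var_n\<close> the coefficient of
        P is then -2 \<open>var n\<close>: one copy completes the recurrence for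
        \<open>p (Suc n)\<close>, the other is the claimed remainder.\<close>
      have "C (p n) = [:- mu, 1:] * p n - [:- mu, 1:] * Q + smult \<Delta> (L P) - [:\<tau>, \<alpha>:] * P - C Q"
        unfolding n[THEN arg_cong[of _ _ C]] C_diff C_linear_factor P(2) by (simp add: algebra_simps)
      also have "\<dots> = [:- mu, 1:] * p n - smult \<alpha> (p n)
          - smult (v + v + \<tau> + \<alpha> * mu - \<Delta> * of_nat m) P"
        unfolding XQ affine P(1) CQ
        by (simp add: smult_add_left smult_diff_left smult_add_right algebra_simps)
           (simp only: mult_2_right smult_add_left smult_add_right)
      also have "\<dots> = ([:- mu, 1:] * p n - smult \<alpha> (p n) - smult (var n) P) - smult (var n) P"
        unfolding var_n[symmetric] smult_add_left by (simp only: diff_diff_eq add.assoc)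
      also have "\<dots> = p (Suc n) - smult (var n) P"
        by (simp only: P_n p_Suc[of n] mean_n)
      finally show ?thesis .
    qed
    ultimately show ?thesis
      using Suc by (simp add: P_def)
  qed
qed

end

section \<open>Chaos spaces and monic orthogonal polynomials of a random variable\<close>

lemma poly_rvs_le_subset: "poly_rvs_le M X n \<subseteq> poly_rvs M X"
  by (auto simp: poly_rvs_le_def poly_rvs_def)

lemma chaos_subset: "chaos M X n \<subseteq> poly_rvs M X"
  using poly_rvs_le_subset by (auto simp: chaos_def)

locale polynomial_random_variables = prob_space M for M :: "'a measure" +
  fixes X :: "'a \<Rightarrow> real"
  assumes moments: "finite_moments M X"
begin

lemma cnj_measurable [measurable]:
  "g \<in> borel_measurable M \<Longrightarrow> (\<lambda>\<omega>. cnj (g \<omega>)) \<in> borel_measurable M"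
  by (rule borel_measurable_continuous_on) (auto intro: continuous_intros)

lemma X_measurable [measurable]: "X \<in> borel_measurable M"
  using moments by (simp add: finite_moments_def)

lemma rv_poly_eq_sum: "rv_poly X q \<omega> = (\<Sum>i\<le>degree q. coeff q i * of_real (X \<omega> ^ i))"
  by (simp add: rv_poly_def poly_altdef)

lemma rv_poly_measurable [measurable]: "rv_poly X q \<in> borel_measurable M"
  unfolding rv_poly_eq_sum[abs_def] by measurable

lemma rv_poly_in_poly_rvs: "rv_poly X q \<in> poly_rvs M X"
  by (auto simp: poly_rvs_def)

lemma rv_poly_in_poly_rvs_le: "q = 0 \<or> int (degree q) \<le> n \<Longrightarrow> rv_poly X q \<in> poly_rvs_le M X n"
  by (auto simp: poly_rvs_le_def)

lemma integrable_rv_poly: "integrable M (rv_poly X q)"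
  unfolding rv_poly_eq_sum[abs_def] using moments
  by (intro Bochner_Integration.integrable_sum integrable_mult_right integrable_of_real)
     (simp add: finite_moments_def)

text \<open>Since X is real, conjugation acts on the coefficients only. Integrands of
  \<open>l2_inner\<close> are thus polynomials in X almost surely, hence integrable by the moment
  assumption.\<close>

lemma rv_poly_mult_cnj:
  "rv_poly X p \<omega> * cnj (rv_poly X q \<omega>) = rv_poly X (p * map_poly cnj q) \<omega>"
  using poly_cnj[of q "of_real (X \<omega>)"] by (simp add: rv_poly_def)

lemma l2_inner_self_eq_0_imp:
  assumes "g \<in> poly_rvs M X" and "l2_inner M g g = 0"
  shows "AE \<omega> in M. g \<omega> = 0"
proof -
  obtain q where q: "AE \<omega> in M. g \<omega> = rv_poly X q \<omega>" and [measurable]: "g \<in> borel_measurable M"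
    using assms(1) by (auto simp: poly_rvs_def)
  have "integrable M (\<lambda>\<omega>. g \<omega> * cnj (g \<omega>))"
    using integrable_rv_poly[of "q * map_poly cnj q"]
  proof (rule integrable_cong_AE_imp)
    show "(\<lambda>\<omega>. g \<omega> * cnj (g \<omega>)) \<in> borel_measurable M"
      by measurable
    show "AE \<omega> in M. rv_poly X (q * map_poly cnj q) \<omega> = g \<omega> * cnj (g \<omega>)"
      using q by eventually_elim (simp add: rv_poly_mult_cnj)
  qed
  then have int: "integrable M (\<lambda>\<omega>. complex_of_real ((cmod (g \<omega>))\<^sup>2))"
    by (simp only: complex_norm_square)
  then have int': "integrable M (\<lambda>\<omega>. (cmod (g \<omega>))\<^sup>2)"
    by (simp only: complex_of_real_integrable_eq)
  have "l2_inner M g g = complex_of_real (LINT \<omega>|M. (cmod (g \<omega>))\<^sup>2)"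
    unfolding l2_inner_def by (simp only: complex_norm_square flip: integral_complex_of_real)
  then have "(LINT \<omega>|M. (cmod (g \<omega>))\<^sup>2) = 0"
    using assms(2) by simp
  then have "AE \<omega> in M. (cmod (g \<omega>))\<^sup>2 = 0"
    using integral_nonneg_eq_0_iff_AE[OF int'] by simp
  then show ?thesis
    by simp
qed

text \<open>Such a g is orthogonal to itself.\<close>

lemma chaos_AE_eq_0:
  assumes "g \<in> chaos M X n" and "g \<in> poly_rvs_le M X (int n - 1)"
  shows "AE \<omega> in M. g \<omega> = 0"
  using assms chaos_subset by (intro l2_inner_self_eq_0_imp) (auto simp: chaos_def)

lemma AE_zero_in_chaos:
  assumes [measurable]: "g \<in> borel_measurable M" and "AE \<omega> in M. g \<omega> = 0"
  shows "g \<in> chaos M X n"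
proof -
  have "l2_inner M g h = 0" for h
    unfolding l2_inner_def
    by (rule integral_eq_zero_AE) (use assms(2) in eventually_elim, simp)
  moreover have "g \<in> poly_rvs_le M X (int n)"
    using assms by (auto simp: poly_rvs_le_def rv_poly_def intro!: exI[of _ 0])
  ultimately show ?thesis
    by (simp add: chaos_def)
qed

lemma chaos_cong_AE:
  assumes "g \<in> chaos M X n" and [measurable]: "h \<in> borel_measurable M"
    and gh: "AE \<omega> in M. g \<omega> = h \<omega>"
  shows "h \<in> chaos M X n"
proof -
  obtain q where q: "q = 0 \<or> int (degree q) \<le> int n" "AE \<omega> in M. g \<omega> = rv_poly X q \<omega>"
    and [measurable]: "g \<in> borel_measurable M"
    using assms(1) by (auto simp: chaos_def poly_rvs_le_def)
  have "AE \<omega> in M. h \<omega> = rv_poly X q \<omega>"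
    using q(2) gh by eventually_elim simp
  then have "h \<in> poly_rvs_le M X (int n)"
    using q(1) by (auto simp: poly_rvs_le_def)
  moreover have "l2_inner M h k = l2_inner M g k" if "k \<in> poly_rvs_le M X (int n - 1)" for k
  proof -
    have [measurable]: "k \<in> borel_measurable M"
      using that by (simp add: poly_rvs_le_def)
    show ?thesis
      unfolding l2_inner_def using gh by (intro integral_cong_AE) auto
  qed
  ultimately show ?thesis
    using assms(1) by (simp add: chaos_def)
qed

text \<open>A monomial multiple of q removes the degree n term of a polynomial representing g
  without changing its value at X. Hence g already lies in F_{n-1}.\<close>

lemma chaos_trivial:
  assumes "q \<noteq> 0" and "degree q \<le> n" and q: "AE \<omega> in M. rv_poly X q \<omega> = 0"
    and g: "g \<in> chaos M X n"
  shows "AE \<omega> in M. g \<omega> = 0"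
proof -
  obtain p where p: "p = 0 \<or> int (degree p) \<le> int n" and gp: "AE \<omega> in M. g \<omega> = rv_poly X p \<omega>"
    and meas: "g \<in> borel_measurable M"
    using g by (auto simp: chaos_def poly_rvs_le_def)
  define s where "s = monom (coeff p n / lead_coeff q) (n - degree q) * q"
  have "degree s \<le> n"
    unfolding s_def using degree_mult_le[of "monom (coeff p n / lead_coeff q) (n - degree q)" q]
      degree_monom_le[of "coeff p n / lead_coeff q" "n - degree q"] assms(2) by linarith
  moreover have "coeff s n = coeff p n"
    using assms(1,2) by (simp add: s_def coeff_monom_mult)
  moreover have "degree p \<le> n"
    using p by auto
  ultimately have "degree (p - s) \<le> n" and "coeff (p - s) n = 0"
    by (simp_all add: degree_diff_le)
  then have "p - s = 0 \<or> degree (p - s) < n"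
    by (rule eq_zero_or_degree_less)
  then have "p - s = 0 \<or> int (degree (p - s)) \<le> int n - 1"
    by linarith
  moreover have "AE \<omega> in M. g \<omega> = rv_poly X (p - s) \<omega>"
    using gp q by eventually_elim (simp add: s_def rv_poly_def)
  ultimately have "g \<in> poly_rvs_le M X (int n - 1)"
    using meas by (auto simp: poly_rvs_le_def)
  with g show ?thesis
    by (rule chaos_AE_eq_0)
qed

text \<open>The leading terms cancel, so (p - q)(X) lies in both G_n and F_{n-1} and vanishes almost
  surely. If p - q were nonzero, \<open>chaos_trivial\<close> would make G_n trivial.\<close>

lemma monic_chaos_poly_unique:
  assumes nontriv: "\<not> (\<forall>g \<in> chaos M X n. AE \<omega> in M. g \<omega> = 0)"
    and p: "degree p = n" "lead_coeff p = 1" "rv_poly X p \<in> chaos M X n"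
    and q: "degree q = n" "lead_coeff q = 1" "rv_poly X q \<in> chaos M X n"
  shows "p = q"
proof (rule ccontr)
  assume "p \<noteq> q"
  have deg: "degree (p - q) \<le> n" and "coeff (p - q) n = 0"
    using p q by (auto intro: degree_diff_le)
  then have low: "int (degree (p - q)) \<le> int n - 1"
    using eq_zero_or_degree_less[of "p - q" n] \<open>p \<noteq> q\<close> by auto
  have diff: "l2_inner M (rv_poly X (p - q)) h = 0" if h: "h \<in> poly_rvs_le M X (int n - 1)" for h
  proof -
    obtain r where r: "AE \<omega> in M. h \<omega> = rv_poly X r \<omega>" and [measurable]: "h \<in> borel_measurable M"
      using h by (auto simp: poly_rvs_le_def)
    have int: "integrable M (\<lambda>\<omega>. rv_poly X u \<omega> * cnj (h \<omega>))" for u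
      using integrable_rv_poly[of "u * map_poly cnj r"]
    proof (rule integrable_cong_AE_imp)
      show "AE \<omega> in M. rv_poly X (u * map_poly cnj r) \<omega> = rv_poly X u \<omega> * cnj (h \<omega>)"
        using r by eventually_elim (simp add: rv_poly_mult_cnj)
    qed measurable
    have "l2_inner M (rv_poly X (p - q)) h
        = l2_inner M (rv_poly X p) h - l2_inner M (rv_poly X q) h"
      using Bochner_Integration.integral_diff[OF int[of p] int[of q]]
      by (simp add: l2_inner_def rv_poly_def left_diff_distrib)
    then show ?thesis
      using h p(3) q(3) by (simp add: chaos_def)
  qed
  have "rv_poly X (p - q) \<in> chaos M X n"
    using deg diff by (simp add: chaos_def rv_poly_in_poly_rvs_le)
  then have "AE \<omega> in M. rv_poly X (p - q) \<omega> = 0"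
    using low by (intro chaos_AE_eq_0 rv_poly_in_poly_rvs_le) auto
  then show False
    using chaos_trivial[of "p - q" n] deg \<open>p \<noteq> q\<close> nontriv by auto
qed

lemma monic_chaos_poly_exists:
  assumes "\<not> (\<forall>g \<in> chaos M X n. AE \<omega> in M. g \<omega> = 0)"
  shows "\<exists>p. degree p = n \<and> lead_coeff p = 1 \<and> rv_poly X p \<in> chaos M X n"
proof -
  obtain g where g: "g \<in> chaos M X n" and g0: "\<not> (AE \<omega> in M. g \<omega> = 0)"
    using assms by blast
  obtain q where q: "q = 0 \<or> int (degree q) \<le> int n" and gq: "AE \<omega> in M. g \<omega> = rv_poly X q \<omega>"
    and meas: "g \<in> borel_measurable M"
    using g by (auto simp: chaos_def poly_rvs_le_def)
  \<comment> \<open>A nonzero element of G_n is not in F_{n-1}, so q has degree exactly n and can be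
    made monic.\<close>
  have "\<not> (q = 0 \<or> int (degree q) \<le> int n - 1)"
    using chaos_AE_eq_0[OF g] g0 gq meas by (auto simp: poly_rvs_le_def)
  then have q: "degree q = n" "q \<noteq> 0"
    using q by auto
  define c where "c = inverse (lead_coeff q)"
  have c: "c \<noteq> 0" "c * lead_coeff q = 1"
    using q by (auto simp: c_def)
  have "l2_inner M (rv_poly X (smult c q)) h = c * l2_inner M (rv_poly X q) h" for h
    by (simp add: l2_inner_def rv_poly_def mult.assoc)
  moreover have "rv_poly X q \<in> chaos M X n"
    by (rule chaos_cong_AE[OF g rv_poly_measurable gq])
  ultimately have "rv_poly X (smult c q) \<in> chaos M X n"
    using q by (simp add: chaos_def rv_poly_in_poly_rvs_le)
  then show ?thesis
    using q c by (intro exI[of _ "smult c q"]) simp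
qed

lemma orth_poly_monic:
  assumes "\<not> (\<forall>g \<in> chaos M X n. AE \<omega> in M. g \<omega> = 0)"
  shows "degree (orth_poly M X n) = n \<and> lead_coeff (orth_poly M X n) = 1
    \<and> rv_poly X (orth_poly M X n) \<in> chaos M X n"
proof -
  have "\<exists>!p. degree p = n \<and> lead_coeff p = 1 \<and> rv_poly X p \<in> chaos M X n"
    using monic_chaos_poly_exists[OF assms] monic_chaos_poly_unique[OF assms] by blast
  from theI'[OF this] show ?thesis
    using assms unfolding orth_poly_def by auto
qed

lemma rv_orth_poly_in_chaos: "rv_poly X (orth_poly M X n) \<in> chaos M X n"
proof (cases "\<forall>g \<in> chaos M X n. AE \<omega> in M. g \<omega> = 0")
  case True
  then have "orth_poly M X n = 0"
    by (simp add: orth_poly_def)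
  then show ?thesis
    by (intro AE_zero_in_chaos) (auto simp: rv_poly_def)
next
  case False
  then show ?thesis
    using orth_poly_monic by blast
qed

text \<open>All members of F_{-1} vanish almost surely, so the constant 1 is orthogonal to them, and
  it is not almost surely zero on a probability space.\<close>

lemma orth_poly_0: "orth_poly M X 0 = 1"
proof -
  have "rv_poly X 1 \<in> chaos M X 0"
  proof -
    have "l2_inner M (rv_poly X 1) h = 0" if "h \<in> poly_rvs_le M X (- 1)" for h
    proof -
      have "AE \<omega> in M. h \<omega> = 0"
        using that by (auto simp: poly_rvs_le_def rv_poly_def)
      then show ?thesis
        unfolding l2_inner_def by (intro integral_eq_zero_AE) (auto elim: eventually_mono)
    qed
    then show ?thesis
      by (simp add: chaos_def rv_poly_in_poly_rvs_le)
  qed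
  moreover have "\<not> (AE \<omega> in M. rv_poly X 1 \<omega> = 0)"
    by (simp add: rv_poly_def)
  ultimately have "degree (orth_poly M X 0) = 0 \<and> lead_coeff (orth_poly M X 0) = 1"
    using orth_poly_monic[of 0] by blast
  then show ?thesis
    by (metis degree_0_id one_poly_eq_simps(1) pCons_one)
qed

lemma takes_exactly_orth_poly_eq_0:
  assumes "takes_exactly M X K" and "K \<le> n"
  shows "orth_poly M X n = 0"
proof -
  obtain S where S: "finite S" "card S = K" "AE \<omega> in M. X \<omega> \<in> S"
    using assms(1) by (auto simp: takes_exactly_def)
  \<comment> \<open>This polynomial of degree K vanishes on the support, so
    \<open>chaos_trivial\<close> applies from index K on.\<close>
  define q where "q = (\<Prod>x\<in>S. [:- complex_of_real x, 1:])"
  have "q \<noteq> 0"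
    using S(1) by (simp add: q_def)
  moreover have "degree q = K"
    using S by (simp add: q_def degree_prod_eq_sum_degree)
  moreover have "AE \<omega> in M. rv_poly X q \<omega> = 0"
    using S(3) by eventually_elim (use S(1) in \<open>auto simp: rv_poly_def q_def poly_prod\<close>)
  ultimately have "\<forall>g \<in> chaos M X n. AE \<omega> in M. g \<omega> = 0"
    using chaos_trivial[of q n] assms(2) by auto
  then show ?thesis
    by (simp add: orth_poly_def)
qed

text \<open>On a probability space X cannot lie almost surely in the empty set. Positivity places K
  in the range from 1 on where the formula for \<open>w\<close> is prescribed.\<close>

lemma takes_exactly_pos:
  assumes "takes_exactly M X K"
  shows "K > 0"
  using assms by (auto simp: takes_exactly_def intro!: Nat.gr0I)

end

section \<open>Meixner polynomials as members of the chaos spaces\<close>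

text \<open>The recurrence polynomials are compared with \<open>orth_poly\<close> at X and not as
  polynomials: on a finite support \<open>orth_poly\<close> is 0 from index K on, whereas the
  recurrence polynomials stay monic and supply a basis in every degree.\<close>

lemma classical_meixner_poly_in_chaos:
  fixes \<alpha> \<alpha>\<^sub>0 \<beta> t :: real
  assumes "prob_space M" and meixner: "classical_meixner M X \<alpha> \<alpha>\<^sub>0 \<beta> t"
  shows "rv_poly X (recurrence_poly (\<lambda>n. complex_of_real (\<alpha> * of_nat n + \<alpha>\<^sub>0))
    (\<lambda>n. complex_of_real (\<beta> * (of_nat n)\<^sup>2 + (t - \<beta>) * of_nat n)) n) \<in> chaos M X n"
proof -
  interpret prob_space M by fact
  interpret polynomial_random_variables M X
    by standard (use meixner in \<open>simp add: classical_meixner_def\<close>)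
  define mean var where "mean n = \<alpha> * of_nat n + \<alpha>\<^sub>0"
    and "var n = \<beta> * (of_nat n)\<^sup>2 + (t - \<beta>) * of_nat n" for n
  define p where "p = recurrence_poly (\<lambda>n. complex_of_real (mean n)) (\<lambda>n. complex_of_real (var n))"
  define f where "f = orth_poly M X"
  obtain a w where rec: "\<And>n. AE \<omega> in M.
      of_real (X \<omega>) * rv_poly X (f n) \<omega> = rv_poly X (f (n + 1)) \<omega>
       + of_real (a n) * rv_poly X (f n) \<omega>
       + of_real (w n) * (if n = 0 then 0 else rv_poly X (f (n - 1)) \<omega>)"
    and fin: "\<And>K. takes_exactly M X K \<Longrightarrow> w K = 0 \<and> (\<forall>n<K. a n = mean n)
          \<and> (\<forall>n. 1 \<le> n \<and> n \<le> K \<longrightarrow> w n = var n)"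
    and inf: "\<nexists>K. takes_exactly M X K \<Longrightarrow> (\<forall>n. a n = mean n) \<and> (\<forall>n\<ge>1. w n = var n)"
    using meixner unfolding classical_meixner_def szego_jacobi_def mean_def var_def f_def by blast
  \<comment> \<open>The hypothesis on \<open>w n\<close> is restricted to n > 0, as the last term of
    the recurrence is absent at n = 0.\<close>
  have step: "AE \<omega> in M. rv_poly X (f (Suc n)) \<omega> = rv_poly X (p (Suc n)) \<omega>"
    if "AE \<omega> in M. rv_poly X (f n) \<omega> = rv_poly X (p n) \<omega>"
      and "n > 0 \<Longrightarrow> AE \<omega> in M. rv_poly X (f (n - 1)) \<omega> = rv_poly X (p (n - 1)) \<omega>"
      and "a n = mean n" and "n > 0 \<Longrightarrow> w n = var n" for n
  proof (cases "n = 0")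
    case True
    show ?thesis
      using rec[of n] that(1)
      by eventually_elim (use that(3) True in \<open>simp add: p_def rv_poly_def algebra_simps\<close>)
  next
    case False
    show ?thesis
      using rec[of n] that(1) that(2)[OF False[unfolded neq0_conv]]
      by eventually_elim (use that(3,4) False in \<open>simp add: p_def rv_poly_def algebra_simps\<close>)
  qed
  have f0: "AE \<omega> in M. rv_poly X (f 0) \<omega> = rv_poly X (p 0) \<omega>"
    by (simp add: f_def p_def orth_poly_0)
  have "AE \<omega> in M. rv_poly X (f n) \<omega> = rv_poly X (p n) \<omega>"
  proof (cases "\<exists>K. takes_exactly M X K")
    case False
    then show ?thesis
    proof (induction n rule: less_induct)
      case (less n)
      then show ?case
        using inf f0 step[of "n - 1"] by (cases n) auto
    qed
  next
    case True
    then obtain K where K: "takes_exactly M X K" ..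
    have "K > 0"
      using takes_exactly_pos[OF K] .
    show ?thesis
    proof (induction n rule: less_induct)
      case (less n)
      \<comment> \<open>Up to K the prescribed parameters give \<open>step\<close>. At K + 1 the
        value \<open>a K\<close> is not prescribed, but \<open>var K = w K = 0\<close> makes p_K a
        factor of p_{K+1}, and p_K(X) = 0. Beyond that, both predecessors vanish at X, so any
        coefficients give 0.\<close>
      consider "n = 0" | "0 < n" "n \<le> K" | "n = Suc K" | "Suc K < n"
        by linarith
      then show ?case
      proof cases
        case 1
        then show ?thesis using f0 by simp
      next
        case 2
        then show ?thesis
          using fin[OF K] less.IH step[of "n - 1"] by (cases n) auto
      next
        case 3
        have "var K = 0"
          using fin[OF K] \<open>K > 0\<close> by auto
        then have "p n = [:- of_real (mean K), 1:] * p K"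
          by (simp add: p_def 3)
        moreover have "f n = 0" "f K = 0"
          using 3 takes_exactly_orth_poly_eq_0[OF K] by (auto simp: f_def)
        moreover have "AE \<omega> in M. rv_poly X (f K) \<omega> = rv_poly X (p K) \<omega>"
          using less.IH[of K] 3 by simp
        ultimately show ?thesis
          by (auto simp: rv_poly_def elim!: eventually_mono)
      next
        case 4
        then obtain m where m: "n = Suc m" "K < m"
          by (cases n) auto
        have "f n = 0" "f m = 0" "f (m - 1) = 0"
          using m takes_exactly_orth_poly_eq_0[OF K] by (auto simp: f_def)
        moreover have "AE \<omega> in M. rv_poly X (f m) \<omega> = rv_poly X (p m) \<omega>"
          and "AE \<omega> in M. rv_poly X (f (m - 1)) \<omega> = rv_poly X (p (m - 1)) \<omega>"
          using less.IH m by auto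
        ultimately have "AE \<omega> in M. rv_poly X (p m) \<omega> = 0 \<and> rv_poly X (p (m - 1)) \<omega> = 0"
          by (auto simp: rv_poly_def)
        then show ?thesis
          unfolding \<open>f n = 0\<close> unfolding m(1)
          by eventually_elim (simp add: p_def rv_poly_def)
      qed
    qed
  qed
  then have "rv_poly X (p n) \<in> chaos M X n"
    using chaos_cong_AE[OF rv_orth_poly_in_chaos[of n] rv_poly_measurable] unfolding f_def by blast
  then show ?thesis
    by (simp only: p_def mean_def var_def)
qed

section \<open>Identification of the number operator\<close>

lemma rv_poly_meixner_op:
  "rv_poly X (meixner_op \<alpha> \<alpha>\<^sub>0 \<tau> A B f) \<omega> =
    (of_real (X \<omega>) - \<alpha>\<^sub>0) * rv_poly X (A f) \<omega> - (\<alpha> * of_real (X \<omega>) + \<tau>) * rv_poly X (B f) \<omega>"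
  by (simp add: meixner_op_def rv_poly_def algebra_simps)

text \<open>Both sides are linear and have eigenvalue n on p_n(X). As p_n is monic of degree n for
  every n, these polynomials span all polynomials.\<close>

lemma number_operator_eq_meixner_op:
  fixes \<alpha> \<alpha>\<^sub>0 \<beta> t \<tau> \<Delta> :: real
  assumes "prob_space M" and meixner: "classical_meixner M X \<alpha> \<alpha>\<^sub>0 \<beta> t"
    and N: "number_operator M X N"
    and "meixner_operators (complex_of_real \<alpha>) (of_real \<alpha>\<^sub>0) (of_real \<beta>) (of_real t) (of_real \<tau>)
      (of_real \<Delta>) A B"
  shows "AE \<omega> in M. N (rv_poly X f) \<omega>
    = rv_poly X (meixner_op (of_real \<alpha>) (of_real \<alpha>\<^sub>0) (of_real \<tau>) A B f) \<omega>"
proof -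
  interpret prob_space M by fact
  interpret polynomial_random_variables M X
    by standard (use meixner in \<open>simp add: classical_meixner_def\<close>)
  interpret meixner_operators "complex_of_real \<alpha>" "of_real \<alpha>\<^sub>0" "of_real \<beta>" "of_real t" "of_real \<tau>"
      "of_real \<Delta>" A B by fact
  let ?P = "\<lambda>f. AE \<omega> in M. N (rv_poly X f) \<omega> = rv_poly X (L f) \<omega>"
  have basis: "?P (p n)" for n
  proof -
    have "rv_poly X (p n) \<in> chaos M X n"
      using classical_meixner_poly_in_chaos[OF assms(1) meixner, of n] by simp
    then have "AE \<omega> in M. N (rv_poly X (p n)) \<omega> = of_nat n * rv_poly X (p n) \<omega>"
      using N by (simp add: number_operator_def)
    then show ?thesis
      using L_C_p[of n] by (simp add: rv_poly_def)
  qed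
  have comb: "?P (smult c g + h)" if "?P g" and "?P h" for c g h
  proof -
    have "AE \<omega> in M. N (\<lambda>\<omega>. c * rv_poly X g \<omega> + 1 * rv_poly X h \<omega>) \<omega>
        = c * N (rv_poly X g) \<omega> + 1 * N (rv_poly X h) \<omega>"
      using N rv_poly_in_poly_rvs unfolding number_operator_def by blast
    moreover have "(\<lambda>\<omega>. c * rv_poly X g \<omega> + 1 * rv_poly X h \<omega>) = rv_poly X (smult c g + h)"
      by (simp add: rv_poly_def fun_eq_iff)
    moreover have "L (smult c g + h) = smult c (L g) + L h"
      using L_diff[of "smult c g + h" h] by (simp add: L_smult)
    ultimately show ?thesis
      using that by (auto simp: rv_poly_def)
  qed
  show "?P f"
  proof (induction "degree f" arbitrary: f rule: less_induct)
    case less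
    define n where "n = degree f"
    define g where "g = f - smult (lead_coeff f) (p n)"
    have p: "degree (p n) = n" "lead_coeff (p n) = 1"
      using recurrence_poly_degree_monic by auto
    have "degree g \<le> n"
      unfolding g_def n_def[symmetric] using p degree_smult_le[of "lead_coeff f" "p n"]
      by (intro degree_diff_le) (auto simp: n_def)
    moreover have "coeff g n = 0"
      using p by (simp add: g_def n_def)
    ultimately have "g = 0 \<or> degree g < degree f"
      unfolding n_def using eq_zero_or_degree_less by blast
    \<comment> \<open>The zero polynomial is obtained as a linear combination, so linearity yields N
      0 = 0 almost surely.\<close>
    moreover have "?P (smult (- 1) (p 0) + p 0)"
      using basis by (intro comb)
    then have "?P 0"
      by (simp only: smult_minus_left smult_1_left add.left_inverse)
    ultimately have "?P g"
      using less by blast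
    then have "?P (smult (lead_coeff f) (p n) + g)"
      using basis by (intro comb)
    moreover have "smult (lead_coeff f) (p n) + g = f"
      by (simp only: g_def add_diff_cancel_left' add_diff_eq)
    ultimately show ?case
      by (simp only:)
  qed
qed

section \<open>The translation and differentiation cases\<close>

text \<open>The commutators are checked pointwise. Splitting x + \<delta> and x - \<delta> leaves
  (f(x + \<delta>) + f(x - \<delta>))/2 = f + \<Delta>Bf for A, and (f(x + \<delta>) - f(x -
  \<delta>))/(2\<delta>) = Af for B.\<close>

lemma meixner_operators_translate:
  fixes \<alpha> \<alpha>\<^sub>0 \<beta> t \<tau> \<Delta> \<delta> :: complex
  assumes "\<Delta> \<noteq> 0" and \<delta>: "\<delta>\<^sup>2 = \<Delta>" and "\<Delta> = \<alpha>\<^sup>2 - 4 * \<beta>" and "\<tau> = 2 * t - \<alpha> * \<alpha>\<^sub>0"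
  shows "meixner_operators \<alpha> \<alpha>\<^sub>0 \<beta> t \<tau> \<Delta>
    (\<lambda>f. smult (1 / (2 * \<delta>)) (translate \<delta> f - translate (- \<delta>) f))
    (\<lambda>f. smult (1 / (2 * \<delta>\<^sup>2)) (translate \<delta> f + translate (- \<delta>) f - smult 2 f))"
    (is "meixner_operators _ _ _ _ _ _ ?A ?B")
proof
  have "\<delta> \<noteq> 0"
    using assms(1,2) by auto
  have poly_ext: "p = q" if "\<And>x. poly p x = poly q x" for p q :: "complex poly"
    using that by (simp add: fun_eq_iff flip: poly_eq_poly_eq_iff)
  have A: "poly (?A f) x = (poly f (x + \<delta>) - poly f (x - \<delta>)) / (2 * \<delta>)"
    and B: "poly (?B f) x = (poly f (x + \<delta>) + poly f (x - \<delta>) - 2 * poly f x) / (2 * \<delta>\<^sup>2)" for f x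
    by (simp_all add: translate_def poly_pcompose add.commute)
  fix f g :: "complex poly" and c :: complex
  show "?A (f - g) = ?A f - ?A g" "?B (f - g) = ?B f - ?B g"
    by (simp_all add: translate_def pcompose_diff smult_add_right smult_diff_right)
  show "?A (smult c f) = smult c (?A f)" "?B (smult c f) = smult c (?B f)"
    by (simp_all add: translate_def pcompose_smult smult_add_right smult_diff_right mult_ac)
  show "?A 1 = 0" "?B 1 = 0"
    by (rule poly_ext; simp only: A B; simp)+
  show "?A ([:0, 1:] * f) = [:0, 1:] * ?A f + f + smult \<Delta> (?B f)"
  proof (rule poly_ext)
    fix x
    have DB: "poly (smult \<Delta> (?B f)) x = (poly f (x + \<delta>) + poly f (x - \<delta>) - 2 * poly f x) / 2"
      by (subst poly_smult, subst B) (use assms(1) \<delta> in simp)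
    show "poly (?A ([:0, 1:] * f)) x = poly ([:0, 1:] * ?A f + f + smult \<Delta> (?B f)) x"
      using \<open>\<delta> \<noteq> 0\<close> unfolding poly_add poly_mult DB A by (simp add: field_simps)
  qed
  show "?B ([:0, 1:] * f) = [:0, 1:] * ?B f + ?A f"
    using \<open>\<delta> \<noteq> 0\<close>
    by (intro poly_ext, unfold poly_add poly_mult A B) (simp add: field_simps power2_eq_square)
qed (use assms(3,4) in auto)

text \<open>By the Leibniz rule [D, x] = 1 and [D^2, x] = 2D; the factor 1/2 in B turns the latter
  into [B, x] = A.\<close>

lemma meixner_operators_pderiv:
  fixes \<alpha> \<alpha>\<^sub>0 \<beta> t \<tau> :: complex
  assumes "\<alpha>\<^sup>2 - 4 * \<beta> = 0" and "\<tau> = 2 * t - \<alpha> * \<alpha>\<^sub>0"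
  shows "meixner_operators \<alpha> \<alpha>\<^sub>0 \<beta> t \<tau> 0 pderiv (\<lambda>f. smult (1 / 2) (pderiv (pderiv f)))"
proof -
  have half: "smult (1 / 2) (g * 2) = g" for g :: "complex poly"
    by (simp only: mult_2_right smult_add_right flip: smult_add_left) simp
  show ?thesis
    using assms
    by unfold_locales
      (simp_all add: pderiv_diff pderiv_smult pderiv_mult pderiv_pCons pderiv_add smult_diff_right
        smult_add_right half algebra_simps)
qed

theorem mainTheorem2:
  fixes M :: "'a measure" and X :: "'a \<Rightarrow> real"
    and \<alpha> \<alpha>\<^sub>0 \<beta> t \<Delta> \<tau> :: real
    and N :: "('a \<Rightarrow> complex) \<Rightarrow> 'a \<Rightarrow> complex"
  assumes "prob_space M"
    and "classical_meixner M X \<alpha> \<alpha>\<^sub>0 \<beta> t"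
    and "t > 0"
    and "number_operator M X N"
    and "\<Delta> = \<alpha>\<^sup>2 - 4 * \<beta>"
    and "\<tau> = 2 * t - \<alpha> * \<alpha>\<^sub>0"
  shows "(\<Delta> \<noteq> 0 \<longrightarrow> (\<forall>\<delta>::complex. \<delta>\<^sup>2 = of_real \<Delta> \<longrightarrow>
           (\<forall>f::complex poly. AE \<omega> in M.
              N (rv_poly X f) \<omega> =
                of_real (X \<omega> - \<alpha>\<^sub>0) / (2 * \<delta>)
                  * (rv_poly X (translate \<delta> f) \<omega> - rv_poly X (translate (- \<delta>) f) \<omega>)
                - 1 / (2 * \<delta>\<^sup>2) * of_real (\<alpha> * X \<omega> + \<tau>)
                  * (rv_poly X (translate \<delta> f) \<omega> + rv_poly X (translate (- \<delta>) f) \<omega>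
                     - 2 * rv_poly X f \<omega>)))) \<and>
         (\<Delta> = 0 \<longrightarrow>
           (\<forall>f::complex poly. AE \<omega> in M.
              N (rv_poly X f) \<omega> =
                of_real (X \<omega> - \<alpha>\<^sub>0) * rv_poly X (pderiv f) \<omega>
                - 1 / 2 * of_real (\<alpha> * X \<omega> + \<tau>) * rv_poly X (pderiv (pderiv f)) \<omega>))"
proof (intro conjI impI allI)
  \<comment> \<open>Any complex square root of \<Delta> is allowed, which covers negative
    \<Delta>.\<close>
  fix \<delta> :: complex and f
  assume \<Delta>: "\<Delta> \<noteq> 0" and \<delta>: "\<delta>\<^sup>2 = of_real \<Delta>"
  have "meixner_operators (of_real \<alpha>) (of_real \<alpha>\<^sub>0) (of_real \<beta>) (of_real t) (of_real \<tau>) (of_real \<Delta>)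
    (\<lambda>f. smult (1 / (2 * \<delta>)) (translate \<delta> f - translate (- \<delta>) f))
    (\<lambda>f. smult (1 / (2 * \<delta>\<^sup>2)) (translate \<delta> f + translate (- \<delta>) f - smult 2 f))"
  proof (rule meixner_operators_translate[OF _ \<delta>])
    show "complex_of_real \<Delta> \<noteq> 0"
      using \<Delta> by simp
  qed (simp_all add: assms(5,6))
  from number_operator_eq_meixner_op[OF assms(1,2,4) this, of f]
  show "AE \<omega> in M. N (rv_poly X f) \<omega> =
      of_real (X \<omega> - \<alpha>\<^sub>0) / (2 * \<delta>)
        * (rv_poly X (translate \<delta> f) \<omega> - rv_poly X (translate (- \<delta>) f) \<omega>)
      - 1 / (2 * \<delta>\<^sup>2) * of_real (\<alpha> * X \<omega> + \<tau>)
        * (rv_poly X (translate \<delta> f) \<omega> + rv_poly X (translate (- \<delta>) f) \<omega> - 2 * rv_poly X f \<omega>)"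
    by eventually_elim (simp add: rv_poly_meixner_op, simp add: rv_poly_def mult_ac)
next
  fix f
  assume \<Delta>: "\<Delta> = 0"
  then have "\<alpha>\<^sup>2 = 4 * \<beta>"
    using assms(5) by simp
  from arg_cong[OF this, of complex_of_real]
  have "meixner_operators (of_real \<alpha>) (of_real \<alpha>\<^sub>0) (of_real \<beta>) (of_real t) (of_real \<tau>)
    0 pderiv (\<lambda>f. smult (1 / 2 :: complex) (pderiv (pderiv f)))"
    by (intro meixner_operators_pderiv) (simp_all add: assms(6))
  then have "meixner_operators (of_real \<alpha>) (of_real \<alpha>\<^sub>0) (of_real \<beta>) (of_real t) (of_real \<tau>)
    (of_real \<Delta>) pderiv (\<lambda>f. smult (1 / 2 :: complex) (pderiv (pderiv f)))"
    by (simp only: \<Delta> of_real_0)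
  from number_operator_eq_meixner_op[OF assms(1,2,4) this, of f]
  show "AE \<omega> in M. N (rv_poly X f) \<omega> =
      of_real (X \<omega> - \<alpha>\<^sub>0) * rv_poly X (pderiv f) \<omega>
      - 1 / 2 * of_real (\<alpha> * X \<omega> + \<tau>) * rv_poly X (pderiv (pderiv f)) \<omega>"
    by eventually_elim (simp add: rv_poly_meixner_op, simp add: rv_poly_def mult_ac)
qed

end
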